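(* Let $0<q<1$, let $n\ge 1$ be an integer, and let $0<2\alpha<n$. Then there exists $\sigma\in\mathcal{M}^+(\mathbb{R}^n)$ such that $$\int_{\mathbb{R}^n}\big(\mathbf{I}_{2\alpha}\sigma\big)^{\frac{q}{1-q}}\,d\sigma<+\infty$$ and $$\sup_{x\in\mathbb{R}^n}\int_{\mathbb{R}^n}\frac{d\sigma(y)}{|x-y|^{(n-2\alpha)q}}<+\infty,$$ but $$\sup\left\{\frac{\Vert \mathbf{I}_{2\alpha}\nu\Vert_{L^q(\mathbb{R}^n,\sigma)}}{\Vert\nu\Vert}\colon\ \nu\in\mathcal{M}^+(\mathbb{R}^n),\ \nu\ne 0,\ \Vert\nu\Vert<+\infty\right\}=+\infty.$$
   Context: $\mathcal{M}^+(\mathbb{R}^n)$ is the class of positive locally finite Borel (Radon) measures on $\mathbb{R}^n$, and $\Vert\nu\Vert=\nu(\mathbb{R}^n)$. The Riesz potential of $\nu\in\mathcal{M}^+(\mathbb{R}^n)$ is $\mathbf{I}_{2\alpha}\nu(x)=\int_{\mathbb{R}^n}\frac{d\nu(y)}{|x-y|^{n-2\alpha}}$, $x\in\mathbb{R}^n$, and $\Vert g\Vert_{L^q(\mathbb{R}^n,\sigma)}=\left(\int_{\mathbb{R}^n}|g|^q\,d\sigma\right)^{1/q}$ (a value in $[0,+\infty]$). *)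

theory Defs
  imports "HOL-Analysis.Analysis"
begin

(* On real ^ 'n every locally finite Borel measure is automatically regular, so finiteness
   on compact sets is the whole Radon condition. *)
definition radon_measures :: "(real ^ 'n) measure set" where
  "radon_measures =
     {\<nu>. sets \<nu> = sets borel \<and> (\<forall>K. compact K \<longrightarrow> emeasure \<nu> K < \<infinity>)}"

(* The kernel 1 / |x - y|^s, for s > 0.  The reciprocal is taken in ennreal, so the kernel is
   infinite on the diagonal; a negative real exponent would give 0 there, since 0 powr a = 0. *)
definition riesz_kernel :: "real \<Rightarrow> real ^ 'n \<Rightarrow> real ^ 'n \<Rightarrow> ennreal" where
  "riesz_kernel s x y = 1 / ennreal (norm (x - y) powr s)"

(* I_\<beta> \<nu>; the argument \<beta> is the full order, i.e. \<beta> = 2 * \<alpha> for the potential I_{2 \<alpha>}. *)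
definition riesz_potential :: "real \<Rightarrow> (real ^ 'n) measure \<Rightarrow> real ^ 'n \<Rightarrow> ennreal" where
  "riesz_potential \<beta> \<nu> x = (\<integral>\<^sup>+ y. riesz_kernel (real CARD('n) - \<beta>) x y \<partial>\<nu>)"

(* Power with exponent p > 0 on [0, \<infinity>], with \<infinity>^p = \<infinity>. *)
definition ennreal_powr :: "ennreal \<Rightarrow> real \<Rightarrow> ennreal" where
  "ennreal_powr t p = (if t = \<infinity> then \<infinity> else ennreal (enn2real t powr p))"

definition Lq_norm :: "real \<Rightarrow> 'a measure \<Rightarrow> ('a \<Rightarrow> ennreal) \<Rightarrow> ennreal" where
  "Lq_norm q \<sigma> g = ennreal_powr (\<integral>\<^sup>+ x. ennreal_powr (g x) q \<partial>\<sigma>) (1 / q)"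

end

theory Submission
  imports Defs "HOL-Library.Discrete_Functions"
begin

text \<open>
  Put \<open>s = n - 2\<alpha>\<close>, \<open>t = s q\<close> and \<open>p = q / (1 - q)\<close>. A sublinear norm
  (\<open>q < 1\<close>) rewards spreading out: if \<open>\<sigma>\<close> splits into widely separated clusters and each
  cluster \<open>k\<close> has the potential \<open>A\<^sub>k = \<integral> \<bar>x\<^sub>k - y\<bar>\<^sup>-\<^sup>t d\<sigma>\<close> of order \<open>n - t\<close> at its centre
  \<open>x\<^sub>k\<close>, then \<open>J\<close> unit point masses at the centres give an \<open>L\<^sup>q\<close> norm of size about
  \<open>J\<^sup>1\<^sup>/\<^sup>q\<close> against a total mass \<open>J\<close>. So it is enough to have infinitely many clusters with
  \<open>A\<^sub>k\<close> bounded above and below while the total energy \<open>\<integral> (I \<sigma>)\<^sup>p d\<sigma>\<close> remains finite.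

  Dilating a cluster and rescaling its mass so as to keep \<open>A\<^sub>k\<close> does not change its energy; the gain
  comes from distributing \<open>A\<^sub>k\<close> over many scales. A ball of radius \<open>r\<close> at distance about \<open>r\<close>
  from the centre, with mass \<open>c r\<^sup>t\<close>, contributes about \<open>c\<close> to \<open>A\<^sub>k\<close> but only \<open>c\<^sup>1\<^sup>+\<^sup>p\<close>
  to the energy. Hence one sequence of balls of radii \<open>2\<^sup>-\<^sup>i / 16\<close> with \<open>c\<^sub>i = 1 / (i + 1)\<close>
  does everything at once: \<open>\<Sum> c\<^sub>i\<^sup>1\<^sup>+\<^sup>p\<close> converges, whereas \<open>\<Sum> c\<^sub>i\<close> diverges and
  is cut into dyadic blocks whose sums lie between \<open>1/2\<close> and \<open>1\<close>. The block \<open>k\<close> of balls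
  is the cluster around \<open>2 k e\<close>, with \<open>e\<close> a fixed unit vector.

  The quantitative input is that uniform measure on a ball of radius \<open>r\<close> has potential at most
  \<open>C r\<^sup>-\<^sup>s\<close> everywhere (\<open>uniform_cball_potential_bound\<close>). With \<open>t\<close> in place of \<open>s\<close> it makes
  \<open>\<integral> \<bar>x - y\<bar>\<^sup>-\<^sup>t d\<sigma>(y)\<close> bounded in \<open>x\<close>
  (\<open>scattered_potential_bounded\<close>), and because the radii are geometric while \<open>c\<^sub>i\<close> varies slowly, the potential on a ball is comparable to what that ball generates alone
  (\<open>scattered_potential_on_blob\<close>), which gives the energy bound
  (\<open>scattered_energy_finite\<close>). The point masses are treated in
  \<open>point_masses_ratio_unbounded\<close>.
\<close>

section \<open>Riesz kernels and powers of extended reals\<close>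

lemma riesz_kernel_le:
  fixes x y :: "real ^ 'n"
  assumes "0 < d" "d \<le> norm (x - y)" "0 \<le> s"
  shows "riesz_kernel s x y \<le> ennreal (d powr - s)"
proof -
  have "riesz_kernel s x y = ennreal (1 / norm (x - y) powr s)"
    using assms unfolding riesz_kernel_def
    by (subst divide_ennreal[symmetric]) auto
  also have "\<dots> \<le> ennreal (d powr - s)"
  proof (intro ennreal_leI)
    have "d powr s \<le> norm (x - y) powr s" using assms by (intro powr_mono2) auto
    then have "1 / norm (x - y) powr s \<le> 1 / d powr s"
      using assms by (intro divide_left_mono mult_pos_pos) auto
    then show "1 / norm (x - y) powr s \<le> d powr - s" by (simp add: powr_minus_divide)
  qed
  finally show ?thesis .
qed

lemma riesz_kernel_ge:
  fixes x y :: "real ^ 'n"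
  assumes "norm (x - y) \<le> d" "0 < d" "0 \<le> s"
  shows "ennreal (d powr - s) \<le> riesz_kernel s x y"
proof (cases "x = y")
  case True
  then show ?thesis by (simp add: riesz_kernel_def)
next
  case False
  have "ennreal (d powr - s) \<le> ennreal (1 / norm (x - y) powr s)"
    using assms False by (intro ennreal_leI) (auto simp: powr_minus field_simps intro!: powr_mono2)
  also have "\<dots> = riesz_kernel s x y"
    using False unfolding riesz_kernel_def by (subst divide_ennreal[symmetric]) auto
  finally show ?thesis .
qed

lemma riesz_kernel_measurable [measurable]:
  "(\<lambda>(x, y). riesz_kernel s (x :: real ^ 'n) y) \<in> borel_measurable (borel \<Otimes>\<^sub>M borel)"
  unfolding riesz_kernel_def by measurable

lemma riesz_kernel_measurable_right [measurable]:
  "riesz_kernel s (x :: real ^ 'n) \<in> borel_measurable borel"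
  unfolding riesz_kernel_def by measurable

lemma riesz_potential_measurable:
  assumes "sigma_finite_measure \<nu>" "sets \<nu> = sets (borel :: (real ^ 'n) measure)"
  shows "riesz_potential \<beta> \<nu> \<in> borel_measurable borel"
proof -
  interpret sigma_finite_measure \<nu> by fact
  note assms(2)[measurable_cong]
  have "(\<lambda>x. \<integral>\<^sup>+ y. riesz_kernel (real CARD('n) - \<beta>) x y \<partial>\<nu>) \<in> borel_measurable borel"
    by measurable
  then show ?thesis by (simp add: riesz_potential_def[abs_def])
qed

lemma ennreal_powr_measurable [measurable]:
  "(\<lambda>t. ennreal_powr t p) \<in> borel_measurable borel"
  unfolding ennreal_powr_def by measurable

lemma ennreal_powr_mono:
  assumes "a \<le> b" "0 \<le> p" shows "ennreal_powr a p \<le> ennreal_powr b p"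
proof (cases "b = \<infinity>")
  case False
  then have "a \<noteq> \<infinity>" "enn2real a \<le> enn2real b"
    using assms by (auto simp: top.extremum_unique less_top intro!: enn2real_mono)
  then show ?thesis using False assms
    by (auto simp: ennreal_powr_def intro!: ennreal_leI powr_mono2)
qed (simp add: ennreal_powr_def)

lemma ennreal_powr_ennreal: "0 \<le> r \<Longrightarrow> ennreal_powr (ennreal r) p = ennreal (r powr p)"
  by (simp add: ennreal_powr_def)

section \<open>The potential of uniform measure on a ball\<close>

lemma emeasure_uniform_cball_le:
  fixes a x :: "'a :: euclidean_space"
  assumes "0 < r" "0 \<le> \<rho>"
  shows "emeasure (uniform_measure lborel (cball a r)) (cball x \<rho>) \<le> ennreal ((\<rho> / r) ^ DIM('a))"
proof -
  have "emeasure (uniform_measure lborel (cball a r)) (cball x \<rho>)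
      = emeasure lborel (cball a r \<inter> cball x \<rho>) / emeasure lborel (cball a r)"
    by (rule emeasure_uniform_measure) auto
  also have "\<dots> \<le> emeasure lborel (cball x \<rho>) / emeasure lborel (cball a r)"
    by (intro divide_right_mono_ennreal emeasure_mono) auto
  also have "\<dots> = ennreal ((\<rho> / r) ^ DIM('a))"
    using assms unit_ball_vol_pos[of "real DIM('a)", THEN less_imp_neq]
    by (simp add: emeasure_cball divide_ennreal power_divide)
  finally show ?thesis .
qed

lemma prob_uniform_cball:
  fixes a :: "'a :: euclidean_space"
  assumes "0 < r"
  shows "emeasure (uniform_measure lborel (cball a r)) UNIV = 1"
proof -
  have "emeasure lborel (cball a r) \<noteq> 0"
    using assms unit_ball_vol_pos[of "real DIM('a)", THEN less_imp_neq] by (simp add: emeasure_cball)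
  then show ?thesis
    using emeasure_lborel_cball_finite[of a r] by (simp add: less_top)
qed

text \<open>Stated for abstract sets \<open>B\<close>, so that measurability is a hypothesis; the use is with
  concentric balls of shrinking radius.\<close>
lemma nn_integral_weighted_indicators:
  fixes b :: "nat \<Rightarrow> ennreal"
  assumes [measurable]: "\<And>k. B k \<in> sets M" and "emeasure M (space M) = 1"
  shows "(\<integral>\<^sup>+ y. c * (1 + (\<Sum>k. b k * indicator (B k) y)) \<partial>M)
       = c * (1 + (\<Sum>k. b k * emeasure M (B k)))"
proof -
  have "(\<integral>\<^sup>+ y. (\<Sum>k. b k * indicator (B k) y) \<partial>M) = (\<Sum>k. b k * emeasure M (B k))"
    by (subst nn_integral_suminf) (auto simp: nn_integral_cmult_indicator)
  then show ?thesis
    using assms(2) by (simp add: nn_integral_cmult nn_integral_add)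
qed

text \<open>Since \<open>t < n\<close>, the kernel is integrable near its pole. The bound is uniform in \<open>x\<close>: the kernel
  is dominated by a sum over the balls of radius \<open>r / 2\<^sup>k\<close> around \<open>x\<close>, and such a ball has
  mass at most \<open>2\<^sup>-\<^sup>k\<^sup>n\<close> wherever \<open>x\<close> lies.\<close>
lemma uniform_cball_potential_bound:
  fixes t :: real
  assumes "0 < t" "t < real CARD('n)"
  obtains C where "1 \<le> C"
    "\<And>(a :: real ^ 'n) r x. 0 < r \<Longrightarrow>
       (\<integral>\<^sup>+ y. riesz_kernel t x y \<partial>uniform_measure lborel (cball a r)) \<le> ennreal (C * r powr - t)"
proof -
  define \<theta> where "\<theta> = 2 powr t * (1 / 2) ^ CARD('n)"
  have \<theta>: "0 < \<theta>" "\<theta> < 1"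
  proof -
    have "2 powr t < 2 powr real CARD('n)" using assms by (intro powr_less_mono) auto
    then show "\<theta> < 1" "0 < \<theta>"
      by (auto simp: \<theta>_def powr_realpow power_one_over field_simps)
  qed
  define C where "C = 1 + 2 powr t * (1 / (1 - \<theta>))"
  show thesis
  proof (rule that)
    show "1 \<le> C" using \<theta> by (simp add: C_def)
    fix a x :: "real ^ 'n" and r :: real assume r: "0 < r"
    let ?\<mu> = "uniform_measure lborel (cball a r)"
    let ?b = "\<lambda>k. ennreal (2 powr t * (2 powr t) ^ k)"
    let ?B = "\<lambda>k. cball x (r * (1 / 2) ^ k)"
    have pw: "riesz_kernel t x y
        \<le> ennreal (r powr - t) * (1 + (\<Sum>k. ?b k * indicator (?B k) y))" if "y \<noteq> x" for y
    proof (cases "r \<le> norm (x - y)")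
      case True
      have "riesz_kernel t x y \<le> ennreal (r powr - t) * 1"
        using riesz_kernel_le[OF r True, of t] assms by simp
      also have "\<dots> \<le> ennreal (r powr - t) * (1 + (\<Sum>k. ?b k * indicator (?B k) y))"
        by (intro mult_left_mono) auto
      finally show ?thesis .
    next
      case False
      define d where "d = norm (x - y)"
      have d: "0 < d" "d < r" using that False by (auto simp: d_def)
      obtain n where n: "(1 / 2) ^ n < d / r"
        using d r real_arch_pow_inv[of "d / r" "1 / 2"] by auto
      \<comment> \<open>The dyadic scale of the point: it lies between radii \<open>r / 2 ^ Suc k\<close> and \<open>r / 2 ^ k\<close>.\<close>
      define m where "m = (LEAST n. (1 / 2) ^ n < d / r)"
      have m: "(1 / 2) ^ m < d / r" unfolding m_def by (rule LeastI) (rule n)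
      have "m \<noteq> 0" using m d r by (intro notI) (auto simp: field_simps)
      then obtain k where k: "m = Suc k" by (cases m) auto
      have "\<not> (1 / 2) ^ k < d / r"
        using not_less_Least[of k "\<lambda>n. (1 / 2) ^ n < d / r"] by (simp add: m_def[symmetric] k)
      then have "d \<le> r * (1 / 2) ^ k" using r by (simp add: field_simps)
      then have yB: "y \<in> ?B k" by (simp add: d_def dist_norm)
      have "riesz_kernel t x y \<le> ennreal ((r * (1 / 2) ^ Suc k) powr - t)"
        using m r assms by (intro riesz_kernel_le) (auto simp: k d_def[symmetric] field_simps)
      also have "(r * (1 / 2) ^ Suc k) powr - t = r powr - t * (2 powr t * (2 powr t) ^ k)"
      proof -
        have "((1 / 2) ^ Suc k) powr - t = 2 powr t * (2 powr t :: real) ^ k"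
          by (simp add: powr_minus power_one_over powr_divide powr_mult powr_power[symmetric]
               powr_realpow[symmetric] powr_powr field_simps powr_add)
        then show ?thesis using r by (subst powr_mult) auto
      qed
      also have "ennreal \<dots> = ennreal (r powr - t) * (\<Sum>j\<in>{k}. ?b j * indicator (?B j) y)"
        using yB by (simp add: ennreal_mult)
      also have "\<dots> \<le> ennreal (r powr - t) * (\<Sum>j. ?b j * indicator (?B j) y)"
        by (intro mult_left_mono sum_le_suminf) auto
      also have "\<dots> \<le> ennreal (r powr - t) * (1 + (\<Sum>j. ?b j * indicator (?B j) y))"
        by (intro mult_left_mono) auto
      finally show ?thesis .
    qed
    \<comment> \<open>At \<open>y = x\<close> the kernel is infinite and the pointwise bound may fail, but points are null sets.\<close>
    have "AE y in ?\<mu>. y \<noteq> x"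
      by (intro AE_uniform_measureI) (use AE_lborel_singleton[of x] in auto)
    then have "AE y in ?\<mu>. riesz_kernel t x y
        \<le> ennreal (r powr - t) * (1 + (\<Sum>k. ?b k * indicator (?B k) y))"
      by (rule eventually_mono) (rule pw)
    then have "(\<integral>\<^sup>+ y. riesz_kernel t x y \<partial>?\<mu>)
        \<le> (\<integral>\<^sup>+ y. ennreal (r powr - t) * (1 + (\<Sum>k. ?b k * indicator (?B k) y)) \<partial>?\<mu>)"
      by (rule nn_integral_mono_AE)
    also have "\<dots> = ennreal (r powr - t) * (1 + (\<Sum>k. ?b k * emeasure ?\<mu> (?B k)))"
      by (rule nn_integral_weighted_indicators) (simp_all add: prob_uniform_cball r del: emeasure_uniform_measure)
    also have "\<dots> \<le> ennreal (r powr - t) * (1 + (\<Sum>k. ennreal (2 powr t * \<theta> ^ k)))"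
    proof (intro mult_left_mono add_mono suminf_le order_refl)
      fix k
      have "?b k * emeasure ?\<mu> (?B k) \<le> ?b k * ennreal ((r * (1 / 2) ^ k / r) ^ CARD('n))"
        using emeasure_uniform_cball_le[OF r, of "r * (1 / 2) ^ k" a x] r
        by (intro mult_left_mono) auto
      also have "\<dots> = ennreal (2 powr t * \<theta> ^ k)"
        using r by (subst ennreal_mult[symmetric])
          (auto simp: \<theta>_def power_mult_distrib power_mult[symmetric] mult.commute mult.left_commute)
      finally show "?b k * emeasure ?\<mu> (?B k) \<le> ennreal (2 powr t * \<theta> ^ k)" .
    qed auto
    also have "(\<Sum>k. ennreal (2 powr t * \<theta> ^ k)) = ennreal (2 powr t * (1 / (1 - \<theta>)))"
      using \<theta> by (intro suminf_ennreal_eq sums_mult geometric_sums) auto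
    also have "ennreal (r powr - t) * (1 + \<dots>) = ennreal (C * r powr - t)"
      using \<theta> by (simp add: C_def mult.commute ennreal_mult flip: ennreal_plus ennreal_1)
    finally show "(\<integral>\<^sup>+ y. riesz_kernel t x y \<partial>?\<mu>) \<le> ennreal (C * r powr - t)" .
  qed
qed

section \<open>Clusters of balls at all scales\<close>

text \<open>Balls start at radius \<open>1 / 16\<close> and sit at distance \<open>8 * rad i\<close>, at most \<open>1 / 2\<close>, from
  their cluster centre. With these constants the balls are disjoint, the gap between two of them is at
  least the larger radius, and clusters centred at even multiples of \<open>e\<close> stay at distance at least
  one from each other.\<close>
definition rad :: "nat \<Rightarrow> real" where
  "rad i = (1 / 2) ^ i / 16"

text \<open>Cluster \<open>k\<close> consists of the \<open>2 ^ k\<close> indices with \<open>2 ^ k \<le> Suc i < 2 * 2 ^ k\<close>.\<close>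
definition cluster :: "nat \<Rightarrow> nat" where
  "cluster i = floor_log (Suc i)"

definition pos :: "nat \<Rightarrow> real" where
  "pos i = 2 * real (cluster i) + 8 * rad i"

definition blob :: "'a :: euclidean_space \<Rightarrow> nat \<Rightarrow> 'a set" where
  "blob e i = cball (pos i *\<^sub>R e) (rad i)"

text \<open>The factor \<open>rad i powr t\<close> makes the potential with kernel exponent \<open>t\<close> of a weighted ball scale
  invariant, so that the harmonic factor alone decides about convergence.\<close>
definition weight :: "real \<Rightarrow> nat \<Rightarrow> real" where
  "weight t i = rad i powr t / real (Suc i)"

text \<open>The measure \<open>\<Sum> weight t i * \<mu>\<^sub>i\<close>, with \<open>\<mu>\<^sub>i\<close> the uniform probability measure on the ball
  \<open>i\<close>, encoded through its Lebesgue density; \<open>nn_integral_scattered\<close> recovers the sum.\<close>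
definition scattered :: "'a :: euclidean_space \<Rightarrow> real \<Rightarrow> 'a measure" where
  "scattered e t = density lborel
     (\<lambda>y. \<Sum>i. ennreal (weight t i) * (indicator (blob e i) y / emeasure lborel (blob e i)))"

lemma rad_pos [simp]: "0 < rad i" "0 \<le> rad i" "rad i \<noteq> 0"
  by (auto simp: rad_def)

lemma rad_le: "rad i \<le> 1 / 16"
  by (simp add: rad_def power_le_one)

lemma rad_add: "rad (i + d) = (1 / 2) ^ d * rad i"
  by (simp add: rad_def power_add)

lemma rad_less_half: "i < l \<Longrightarrow> rad l \<le> rad i / 2"
proof -
  assume "i < l"
  then have "rad l = (1 / 2) ^ (l - i) * rad i" using rad_add[of i "l - i"] by simp
  moreover have "(1 / 2 :: real) ^ (l - i) \<le> (1 / 2) ^ 1"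
    using \<open>i < l\<close> by (intro power_decreasing) auto
  ultimately show ?thesis using mult_right_mono[of "(1 / 2 :: real) ^ (l - i)" "1 / 2" "rad i"] by simp
qed

lemma weight_pos [simp]: "0 < weight t i" "0 \<le> weight t i"
  by (auto simp: weight_def)

lemma weight_sum_finite:
  assumes "0 < t" shows "(\<Sum>i. ennreal (weight t i)) < \<infinity>"
proof -
  have le: "weight t i \<le> ((1 / 2) powr t) ^ i" for i
  proof -
    have "rad i powr t \<le> ((1 / 2) ^ i) powr t"
      using assms by (intro powr_mono2) (auto simp: rad_def)
    also have "\<dots> = ((1 / 2) powr t) ^ i"
      by (simp add: powr_realpow[symmetric] powr_powr mult.commute powr_power)
    finally have "rad i powr t \<le> ((1 / 2) powr t) ^ i" .
    moreover have "weight t i \<le> rad i powr t" by (simp add: weight_def field_simps)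
    ultimately show ?thesis by simp
  qed
  have "(1 / 2) powr t < (1 / 2) powr (0 :: real)"
    using assms by (intro powr_less_mono') auto
  then have "(\<Sum>i. ennreal (((1 / 2) powr t) ^ i)) = ennreal (1 / (1 - (1 / 2) powr t))"
    by (intro suminf_ennreal_eq geometric_sums) auto
  moreover have "(\<Sum>i. ennreal (weight t i)) \<le> (\<Sum>i. ennreal (((1 / 2) powr t) ^ i))"
    using le by (intro suminf_le ennreal_leI) auto
  ultimately show ?thesis by (simp add: le_less_trans)
qed

lemma cluster_mono: "i \<le> l \<Longrightarrow> cluster i \<le> cluster l"
  unfolding cluster_def by (intro floor_log_le_iff) auto

lemma pos_separated:
  assumes "i < l" shows "4 * rad i \<le> \<bar>pos i - pos l\<bar>"
proof (cases "cluster i = cluster l")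
  case True
  then show ?thesis using rad_less_half[OF assms] by (simp add: pos_def)
next
  case False
  then have "real (cluster i) + 1 \<le> real (cluster l)" using cluster_mono[of i l] assms by simp
  moreover have "0 < rad l" by simp
  ultimately have "pos l - pos i \<ge> 2 - 8 * rad i" unfolding pos_def by linarith
  then show ?thesis using rad_le[of i] by linarith
qed

lemma blob_separated:
  assumes "norm e = 1" "i < l" "x \<in> blob e i" "y \<in> blob e l"
  shows "rad i \<le> norm (x - y)"
proof -
  have "\<bar>pos i - pos l\<bar> = norm (pos i *\<^sub>R e - pos l *\<^sub>R e)"
    using assms by (simp flip: scaleR_diff_left)
  also have "\<dots> \<le> norm (pos i *\<^sub>R e - x) + norm (x - y) + norm (pos l *\<^sub>R e - y)"
    using norm_triangle_ineq[of "pos i *\<^sub>R e - x" "x - y"]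
      norm_triangle_ineq[of "pos i *\<^sub>R e - x + (x - y)" "y - pos l *\<^sub>R e"]
    by (simp add: norm_minus_commute algebra_simps)
  also have "\<dots> \<le> rad i + norm (x - y) + rad l"
    using assms by (simp add: blob_def dist_norm)
  finally show ?thesis using pos_separated[OF assms(2)] rad_less_half[OF assms(2)] by simp
qed

lemma blob_measurable [measurable]: "blob e i \<in> sets borel"
  by (simp add: blob_def)

lemma sets_scattered [simp, measurable_cong]: "sets (scattered e t) = sets borel"
  by (simp add: scattered_def)

lemma space_scattered [simp]: "space (scattered e t) = UNIV"
  by (simp add: scattered_def)

lemma nn_integral_scattered:
  assumes [measurable]: "g \<in> borel_measurable borel"
  shows "(\<integral>\<^sup>+ y. g y \<partial>scattered e t)
       = (\<Sum>i. ennreal (weight t i) * (\<integral>\<^sup>+ y. g y \<partial>uniform_measure lborel (blob e i)))"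
proof -
  let ?d = "\<lambda>i y. indicator (blob e i) y / emeasure lborel (blob e i)"
  have "(\<integral>\<^sup>+ y. g y \<partial>scattered e t) = (\<integral>\<^sup>+ y. (\<Sum>i. ennreal (weight t i) * ?d i y) * g y \<partial>lborel)"
    unfolding scattered_def by (subst nn_integral_density) auto
  also have "\<dots> = (\<integral>\<^sup>+ y. (\<Sum>i. ennreal (weight t i) * (?d i y * g y)) \<partial>lborel)"
    by (simp only: ennreal_suminf_multc[symmetric] mult.assoc)
  also have "\<dots> = (\<Sum>i. ennreal (weight t i) * (\<integral>\<^sup>+ y. ?d i y * g y \<partial>lborel))"
    by (subst nn_integral_suminf) (auto simp: nn_integral_cmult)
  also have "\<dots> = (\<Sum>i. ennreal (weight t i) * (\<integral>\<^sup>+ y. g y \<partial>uniform_measure lborel (blob e i)))"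
    unfolding uniform_measure_def by (subst nn_integral_density) auto
  finally show ?thesis .
qed

lemma prob_blob: "emeasure (uniform_measure lborel (blob e i)) UNIV = 1"
  unfolding blob_def by (rule prob_uniform_cball) simp

lemma nn_integral_blob_le:
  assumes "\<And>y. y \<in> blob e i \<Longrightarrow> g y \<le> c"
  shows "(\<integral>\<^sup>+ y. g y \<partial>uniform_measure lborel (blob e i)) \<le> c"
proof -
  have "(\<integral>\<^sup>+ y. g y \<partial>uniform_measure lborel (blob e i))
      \<le> (\<integral>\<^sup>+ y. c \<partial>uniform_measure lborel (blob e i))"
    by (intro nn_integral_mono_AE AE_uniform_measureI) (auto simp: assms)
  then show ?thesis using prob_blob[of e i] by (simp del: emeasure_uniform_measure)
qed

lemma nn_integral_blob_ge:
  assumes "\<And>y. y \<in> blob e i \<Longrightarrow> c \<le> g y"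
  shows "c \<le> (\<integral>\<^sup>+ y. g y \<partial>uniform_measure lborel (blob e i))"
proof -
  have "(\<integral>\<^sup>+ y. c \<partial>uniform_measure lborel (blob e i))
      \<le> (\<integral>\<^sup>+ y. g y \<partial>uniform_measure lborel (blob e i))"
    by (intro nn_integral_mono_AE AE_uniform_measureI) (auto simp: assms)
  then show ?thesis using prob_blob[of e i] by (simp del: emeasure_uniform_measure)
qed

lemma emeasure_scattered:
  "emeasure (scattered e t) UNIV = (\<Sum>i. ennreal (weight t i))"
proof -
  have "(\<integral>\<^sup>+ y. 1 \<partial>uniform_measure lborel (blob e i)) = 1" for i
    using prob_blob[of e i] by (simp del: emeasure_uniform_measure)
  then show ?thesis
    using nn_integral_scattered[of "\<lambda>_. 1" e t]
    by (simp only: borel_measurable_const nn_integral_const space_scattered mult_1_left mult_1_right)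
qed

lemma finite_measure_scattered:
  assumes "0 < t" shows "finite_measure (scattered e t)"
proof (rule finite_measureI)
  show "emeasure (scattered e t) (space (scattered e t)) \<noteq> \<infinity>"
    unfolding space_scattered emeasure_scattered
    using weight_sum_finite[OF assms] by (rule less_imp_neq)
qed

section \<open>Finite energy and bounded potential\<close>

text \<open>In natural numbers \<open>(i - l) + (l - i)\<close> is the distance \<open>\<bar>i - l\<bar>\<close>, as one of the two truncated
  differences vanishes. Each distance is attained at most twice, whence the factor \<open>2\<close>.\<close>
lemma two_sided_geometric_sum:
  fixes \<eta> :: real
  assumes "0 < \<eta>" "\<eta> < 1"
  shows "(\<Sum>l. ennreal (real (Suc ((i - l) + (l - i))) * \<eta> ^ ((i - l) + (l - i)))) \<le> ennreal (2 / (1 - \<eta>)\<^sup>2)"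
proof -
  define f where "f d = ennreal (real (Suc d) * \<eta> ^ d)" for d
  have f: "suminf f = ennreal (1 / (1 - \<eta>)\<^sup>2)"
    unfolding f_def using assms by (intro suminf_ennreal_eq geometric_deriv_sums) auto
  have "(\<Sum>l. f ((i - l) + (l - i)))
      = (\<Sum>l. f ((i - (l + Suc i)) + ((l + Suc i) - i))) + (\<Sum>l<Suc i. f ((i - l) + (l - i)))"
    by (rule suminf_offset) auto
  also have "(\<Sum>l. f ((i - (l + Suc i)) + ((l + Suc i) - i))) = (\<Sum>l. f (l + 1))"
    by (simp add: add_ac Suc_diff_le)
  also have "(\<Sum>l<Suc i. f ((i - l) + (l - i))) = (\<Sum>l<Suc i. f (Suc i - Suc l))"
    by (intro sum.cong) auto
  also have "\<dots> = (\<Sum>l<Suc i. f l)" by (rule sum.nat_diff_reindex)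
  also have "(\<Sum>l. f (l + 1)) + (\<Sum>l<Suc i. f l) \<le> suminf f + suminf f"
  proof (intro add_mono)
    show "(\<Sum>l. f (l + 1)) \<le> suminf f"
      by (subst suminf_offset[of f 1]) auto
    show "(\<Sum>l<Suc i. f l) \<le> suminf f" by (intro sum_le_suminf) auto
  qed
  also have "\<dots> = ennreal (2 / (1 - \<eta>)\<^sup>2)"
    unfolding f by (subst ennreal_plus[symmetric]) auto
  finally show ?thesis unfolding f_def .
qed

text \<open>Two balls are apart by at least the larger radius, so the left side is, up to a constant, the
  influence of ball \<open>l\<close> on ball \<open>i\<close>. It decays geometrically in \<open>\<bar>i - l\<bar>\<close>: smaller balls
  (\<open>l > i\<close>) have small mass, at rate \<open>2 powr - t\<close>, and larger balls (\<open>l < i\<close>) have a weak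
  potential, at rate \<open>2 powr - (s - t)\<close>. The linear factor absorbs the quotient
  \<open>Suc i / Suc l\<close> of the harmonic coefficients.\<close>
lemma weight_interaction:
  assumes "0 < t" "t < s"
  shows "weight t l * rad (min i l) powr - s
     \<le> (rad i powr (t - s) / Suc i)
        * (real (Suc ((i - l) + (l - i))) * (max (2 powr - t) (2 powr - (s - t))) ^ ((i - l) + (l - i)))"
proof -
  define \<eta> :: real where "\<eta> = max (2 powr - t) (2 powr - (s - t))"
  have \<eta>: "0 < \<eta>" by (simp add: \<eta>_def less_max_iff_disj)
  have half: "((1 / 2) ^ d) powr u = (2 powr - u) ^ d" for u :: real and d :: nat
    by (simp add: powr_realpow[symmetric] powr_powr powr_divide powr_minus powr_power
         power_one_over field_simps)
  show ?thesis unfolding \<eta>_def[symmetric]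
  proof (cases "l \<le> i")
    case True
    define d where "d = i - l"
    have i: "i = l + d" using True by (simp add: d_def)
    have r: "rad i powr (s - t) = (2 powr - (s - t)) ^ d * rad l powr (s - t)"
      by (simp add: i rad_add powr_mult half)
    have inv: "rad l powr - (s - t) = A * rad i powr - (s - t)"
      if "rad i powr (s - t) = A * rad l powr (s - t)" "0 < A" for A
      using that unfolding powr_minus_divide by simp
    have "rad l powr - (s - t) = (2 powr - (s - t)) ^ d * rad i powr - (s - t)"
      by (rule inv[OF r]) simp
    also have "\<dots> \<le> \<eta> ^ d * rad i powr - (s - t)"
      by (intro mult_right_mono power_mono) (auto simp: \<eta>_def)
    finally have 1: "rad l powr (t - s) \<le> \<eta> ^ d * rad i powr (t - s)" by simp
    have 2: "1 / real (Suc l) \<le> real (Suc d) / real (Suc i)"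
      by (simp add: i field_simps)
    have "weight t l * rad (min i l) powr - s = (1 / real (Suc l)) * rad l powr (t - s)"
      using True by (simp add: weight_def powr_diff powr_minus field_simps)
    also have "\<dots> \<le> (real (Suc d) / real (Suc i)) * (\<eta> ^ d * rad i powr (t - s))"
      using 1 2 \<eta> by (intro mult_mono) auto
    finally show "weight t l * rad (min i l) powr - s
     \<le> (rad i powr (t - s) / Suc i) * (real (Suc ((i - l) + (l - i))) * \<eta> ^ ((i - l) + (l - i)))"
      using True by (simp add: d_def mult_ac)
  next
    case False
    define d where "d = l - i"
    have l: "l = i + d" using False by (simp add: d_def)
    have "rad l powr t = (2 powr - t) ^ d * rad i powr t"
      by (simp add: l rad_add powr_mult half)
    also have "\<dots> \<le> \<eta> ^ d * rad i powr t"
      by (intro mult_right_mono power_mono) (auto simp: \<eta>_def)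
    finally have 1: "rad l powr t * rad i powr - s \<le> \<eta> ^ d * rad i powr t * rad i powr - s"
      by (intro mult_right_mono) auto
    have 2: "1 / real (Suc l) \<le> real (Suc d) / real (Suc i)"
    proof -
      have "1 / real (Suc l) \<le> 1 / real (Suc i)" using False by (simp add: frac_le)
      also have "\<dots> \<le> real (Suc d) / real (Suc i)" by (simp add: divide_right_mono)
      finally show ?thesis .
    qed
    have "weight t l * rad (min i l) powr - s = (1 / real (Suc l)) * (rad l powr t * rad i powr - s)"
      using False by (simp add: weight_def)
    also have "\<dots> \<le> (real (Suc d) / real (Suc i)) * (\<eta> ^ d * rad i powr t * rad i powr - s)"
      using 1 2 \<eta> by (intro mult_mono) auto
    also have "rad i powr t * rad i powr - s = rad i powr (t - s)"
      by (simp flip: powr_add)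
    then have "(real (Suc d) / real (Suc i)) * (\<eta> ^ d * rad i powr t * rad i powr - s)
        = (rad i powr (t - s) / Suc i) * (real (Suc d) * \<eta> ^ d)"
      by (simp add: mult_ac)
    finally show "weight t l * rad (min i l) powr - s
     \<le> (rad i powr (t - s) / Suc i) * (real (Suc ((i - l) + (l - i))) * \<eta> ^ ((i - l) + (l - i)))"
      using False by (simp add: d_def)
  qed
qed

text \<open>Summing the geometrically decaying interactions: up to a constant, the whole measure has on a ball no
  larger potential than the part carried by that ball.\<close>
lemma scattered_potential_on_blob:
  fixes e :: "real ^ 'n"
  assumes "norm e = 1" "0 < t" "t < s" "s < real CARD('n)"
  obtains K where "0 < K"
    "\<And>i x. x \<in> blob e i \<Longrightarrow>
      (\<integral>\<^sup>+ y. riesz_kernel s x y \<partial>scattered e t) \<le> ennreal (K * (rad i powr (t - s) / Suc i))"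
proof -
  obtain C where C: "1 \<le> C" "\<And>(a :: real ^ 'n) r x. 0 < r \<Longrightarrow>
       (\<integral>\<^sup>+ y. riesz_kernel s x y \<partial>uniform_measure lborel (cball a r)) \<le> ennreal (C * r powr - s)"
    using uniform_cball_potential_bound[of s] assms by auto
  define \<eta> :: real where "\<eta> = max (2 powr - t) (2 powr - (s - t))"
  have "2 powr - t < 2 powr (0 :: real)" "2 powr - (s - t) < 2 powr (0 :: real)"
    using assms powr_less_mono[of "- t" 0 2] powr_less_mono[of "- (s - t)" 0 2] by auto
  then have \<eta>: "0 < \<eta>" "\<eta> < 1" by (auto simp: \<eta>_def less_max_iff_disj)
  let ?d = "\<lambda>i l :: nat. (i - l) + (l - i)"
  show thesis
  proof (rule that)
    show "0 < C * (2 / (1 - \<eta>)\<^sup>2)" using C \<eta> by simp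
    fix i x assume x: "x \<in> blob e i"
    let ?A = "rad i powr (t - s) / Suc i"
    have blob: "(\<integral>\<^sup>+ y. riesz_kernel s x y \<partial>uniform_measure lborel (blob e l))
        \<le> ennreal (C * rad (min i l) powr - s)" for l
    proof (cases "l \<le> i")
      case True
      then show ?thesis using C(2)[of "rad l" "pos l *\<^sub>R e" x] by (simp add: blob_def)
    next
      case False
      then have "(\<integral>\<^sup>+ y. riesz_kernel s x y \<partial>uniform_measure lborel (blob e l)) \<le> ennreal (rad i powr - s)"
        using assms x by (intro nn_integral_blob_le riesz_kernel_le blob_separated[of e i l]) auto
      also have "\<dots> \<le> ennreal (C * rad (min i l) powr - s)"
        using C(1) False by (intro ennreal_leI) simp
      finally show ?thesis .
    qed
    have "(\<integral>\<^sup>+ y. riesz_kernel s x y \<partial>scattered e t)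
       = (\<Sum>l. ennreal (weight t l) * (\<integral>\<^sup>+ y. riesz_kernel s x y \<partial>uniform_measure lborel (blob e l)))"
      by (rule nn_integral_scattered) measurable
    also have "\<dots> \<le> (\<Sum>l. ennreal (C * ?A) * ennreal (real (Suc (?d i l)) * \<eta> ^ ?d i l))"
    proof (intro suminf_le)
      fix l
      have "ennreal (weight t l) * (\<integral>\<^sup>+ y. riesz_kernel s x y \<partial>uniform_measure lborel (blob e l))
          \<le> ennreal (weight t l) * ennreal (C * rad (min i l) powr - s)"
        by (intro mult_left_mono blob) auto
      also have "\<dots> = ennreal (C * (weight t l * rad (min i l) powr - s))"
        using C by (subst ennreal_mult[symmetric]) (auto simp: mult_ac)
      also have "\<dots> \<le> ennreal (C * (?A * (real (Suc (?d i l)) * \<eta> ^ ?d i l)))"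
        using C weight_interaction[OF assms(2,3), of l i, folded \<eta>_def]
        by (intro ennreal_leI mult_left_mono) auto
      also have "\<dots> = ennreal (C * ?A) * ennreal (real (Suc (?d i l)) * \<eta> ^ ?d i l)"
        using C \<eta> by (subst ennreal_mult[symmetric]) (auto simp: mult_ac)
      finally show "ennreal (weight t l) * (\<integral>\<^sup>+ y. riesz_kernel s x y \<partial>uniform_measure lborel (blob e l))
          \<le> ennreal (C * ?A) * ennreal (real (Suc (?d i l)) * \<eta> ^ ?d i l)" .
    qed auto
    also have "\<dots> = ennreal (C * ?A) * (\<Sum>l. ennreal (real (Suc (?d i l)) * \<eta> ^ ?d i l))"
      by (rule ennreal_suminf_cmult)
    also have "\<dots> \<le> ennreal (C * ?A) * ennreal (2 / (1 - \<eta>)\<^sup>2)"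
      by (intro mult_left_mono two_sided_geometric_sum \<eta>) auto
    also have "\<dots> = ennreal (C * (2 / (1 - \<eta>)\<^sup>2) * ?A)"
      using C by (subst ennreal_mult[symmetric]) (auto simp: mult_ac)
    finally show "(\<integral>\<^sup>+ y. riesz_kernel s x y \<partial>scattered e t) \<le> ennreal (C * (2 / (1 - \<eta>)\<^sup>2) * ?A)" .
  qed
qed

lemma scattered_radon:
  assumes "0 < t" shows "(scattered e t :: (real ^ 'n) measure) \<in> radon_measures"
proof -
  interpret finite_measure "scattered e t" by (rule finite_measure_scattered[OF assms])
  show ?thesis unfolding radon_measures_def by (simp add: less_top[symmetric])
qed

text \<open>The exponents satisfy \<open>t + (t - s) * p = 0\<close>, the scale invariance of the problem. All powers of
  the radius therefore cancel and ball \<open>i\<close> contributes a constant times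
  \<open>(1 / Suc i) powr (1 + p)\<close>, the term of a convergent series.\<close>
lemma scattered_energy_finite:
  fixes e :: "real ^ 'n"
  assumes "norm e = 1" "0 < q" "q < 1" "0 < \<beta>" "\<beta> < real CARD('n)"
  defines "t \<equiv> (real CARD('n) - \<beta>) * q"
  shows "(\<integral>\<^sup>+ x. ennreal_powr (riesz_potential \<beta> (scattered e t) x) (q / (1 - q)) \<partial>scattered e t) < \<infinity>"
proof -
  define s where "s = real CARD('n) - \<beta>"
  define p where "p = q / (1 - q)"
  have s: "0 < s" "s < real CARD('n)" using assms by (auto simp: s_def)
  have t: "t = s * q" "0 < t" "t < s" using assms s by (auto simp: t_def s_def)
  have p: "0 < p" "t + (t - s) * p = 0" using assms by (auto simp: p_def t field_simps)
  obtain K where K: "0 < K" "\<And>i x. x \<in> blob e i \<Longrightarrow>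
      (\<integral>\<^sup>+ y. riesz_kernel s x y \<partial>scattered e t) \<le> ennreal (K * (rad i powr (t - s) / Suc i))"
    using scattered_potential_on_blob[OF assms(1) t(2,3) s(2)] by metis
  interpret finite_measure "scattered e t" by (rule finite_measure_scattered[OF t(2)])
  have [measurable]: "riesz_potential \<beta> (scattered e t) \<in> borel_measurable borel"
    by (intro riesz_potential_measurable sigma_finite_measure_axioms) simp
  have m: "(\<lambda>x. ennreal_powr (riesz_potential \<beta> (scattered e t) x) p) \<in> borel_measurable borel"
    by measurable
  have "(\<integral>\<^sup>+ x. ennreal_powr (riesz_potential \<beta> (scattered e t) x) p \<partial>scattered e t)
      = (\<Sum>i. ennreal (weight t i) *
         (\<integral>\<^sup>+ x. ennreal_powr (riesz_potential \<beta> (scattered e t) x) p \<partial>uniform_measure lborel (blob e i)))"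
    by (rule nn_integral_scattered[OF m])
  also have "\<dots> \<le> (\<Sum>i. ennreal (K powr p * real (Suc i) powr (- p - 1)))"
  proof (intro suminf_le)
    fix i
    let ?b = "K * (rad i powr (t - s) / Suc i)"
    have "ennreal_powr (riesz_potential \<beta> (scattered e t) x) p \<le> ennreal (?b powr p)"
      if "x \<in> blob e i" for x
    proof -
      have "riesz_potential \<beta> (scattered e t) x \<le> ennreal ?b"
        using K(2)[OF that] by (simp add: riesz_potential_def s_def)
      then have "ennreal_powr (riesz_potential \<beta> (scattered e t) x) p \<le> ennreal_powr (ennreal ?b) p"
        using p by (intro ennreal_powr_mono) auto
      also have "\<dots> = ennreal (?b powr p)"
        using K by (intro ennreal_powr_ennreal) simp
      finally show ?thesis .
    qed
    then have "(\<integral>\<^sup>+ x. ennreal_powr (riesz_potential \<beta> (scattered e t) x) p \<partial>uniform_measure lborel (blob e i))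
        \<le> ennreal (?b powr p)"
      by (rule nn_integral_blob_le)
    then have "ennreal (weight t i) * (\<integral>\<^sup>+ x. ennreal_powr (riesz_potential \<beta> (scattered e t) x) p \<partial>uniform_measure lborel (blob e i))
       \<le> ennreal (weight t i) * ennreal (?b powr p)"
      by (rule mult_left_mono) simp
    also have "\<dots> = ennreal (weight t i * ?b powr p)"
      by (simp add: ennreal_mult)
    also have "weight t i * ?b powr p = K powr p * real (Suc i) powr (- p - 1)"
    proof -
      have b: "?b powr p = K powr p * (rad i powr ((t - s) * p) * real (Suc i) powr - p)"
        using K by (simp add: powr_mult powr_divide powr_powr powr_minus_divide)
      have one: "rad i powr t * rad i powr ((t - s) * p) = 1"
        using p by (simp flip: powr_add)
      have "weight t i * ?b powr p
          = K powr p * (rad i powr t * rad i powr ((t - s) * p)) * (real (Suc i) powr - p / real (Suc i))"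
        by (simp only: b) (simp add: weight_def)
      then show ?thesis unfolding one by (simp add: powr_diff)
    qed
    finally show "ennreal (weight t i) * (\<integral>\<^sup>+ x. ennreal_powr (riesz_potential \<beta> (scattered e t) x) p \<partial>uniform_measure lborel (blob e i))
       \<le> ennreal (K powr p * real (Suc i) powr (- p - 1))" .
  qed auto
  also have "\<dots> < \<infinity>"
  proof -
    have "summable (\<lambda>n. real n powr (- p - 1))"
      using p by (subst summable_real_powr_iff) simp
    then have "summable (\<lambda>i. real (Suc i) powr (- p - 1))"
      by (subst summable_Suc_iff)
    then have "summable (\<lambda>i. K powr p * real (Suc i) powr (- p - 1))"
      by (rule summable_mult)
    then have "(\<Sum>i. ennreal (K powr p * real (Suc i) powr (- p - 1))) \<noteq> top"
      by (rule ennreal_suminf_neq_top) simp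
    then show ?thesis by (simp add: less_top)
  qed
  finally show ?thesis unfolding p_def .
qed

lemma cluster_bounds: "2 ^ cluster i \<le> Suc i" "Suc i < 2 * 2 ^ cluster i"
  unfolding cluster_def by (rule floor_log_exp2_le, simp, rule floor_log_exp2_gt)

text \<open>The \<open>2 ^ k\<close> coefficients in cluster \<open>k\<close> are at most \<open>1 / 2 ^ k\<close>. The index \<open>m\<close> is an integer
  because it will be read off from a coordinate, which may be negative.\<close>
lemma cluster_mass_le:
  "(\<Sum>i. ennreal (if int (cluster i) = m then 1 / real (Suc i) else 0)) \<le> 1"
proof (cases "m < 0")
  case True
  then have "\<And>i. int (cluster i) \<noteq> m" by auto
  then show ?thesis by simp
next
  case False
  define k where "k = nat m"
  let ?I = "{2 ^ k - 1..<2 * 2 ^ k - (1 :: nat)}"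
  let ?f = "\<lambda>i. ennreal (if int (cluster i) = m then 1 / real (Suc i) else 0)"
  have ck: "int (cluster i) = m \<longleftrightarrow> cluster i = k" for i using False by (auto simp: k_def)
  have "(\<Sum>i. ?f i) = (\<Sum>i\<in>?I. ?f i)"
  proof (rule suminf_finite)
    fix i assume "i \<notin> ?I"
    then have "cluster i \<noteq> k" using cluster_bounds[of i] by auto
    then show "?f i = 0" by (simp add: ck)
  qed simp
  also have "\<dots> \<le> (\<Sum>i\<in>?I. ennreal (1 / 2 ^ k))"
  proof (intro sum_mono ennreal_leI)
    fix i assume "i \<in> ?I"
    then have "2 ^ k \<le> Suc i" by auto
    then have "2 ^ k \<le> real (Suc i)" by (metis numeral_power_le_of_nat_cancel_iff)
    then have "1 / real (Suc i) \<le> 1 / 2 ^ k" by (intro divide_left_mono) auto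
    then show "(if int (cluster i) = m then 1 / real (Suc i) else 0) \<le> 1 / 2 ^ k" by simp
  qed
  also have "\<dots> = ennreal (real (2 ^ k) * (1 / 2 ^ k))"
    by (subst ennreal_mult) (auto simp: ennreal_of_nat_eq_real_of_nat)
  also have "\<dots> = 1" by simp
  finally show ?thesis .
qed

text \<open>In the direction of \<open>e\<close>, cluster \<open>k\<close> occupies a part of \<open>[2 k, 2 k + 1]\<close>. Hence a point
  whose \<open>e\<close>-coordinate is in \<open>[2 m, 2 m + 2)\<close> can be close only to the clusters \<open>m\<close> and
  \<open>m + 1\<close>.\<close>
lemma blob_far:
  assumes "norm e = 1" "y \<in> blob e i" "int (cluster i) \<noteq> \<lfloor>(x \<bullet> e) / 2\<rfloor>" "int (cluster i) \<noteq> \<lfloor>(x \<bullet> e) / 2\<rfloor> + 1"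
  shows "1 \<le> norm (x - y)"
proof -
  define m where "m = \<lfloor>(x \<bullet> e) / 2\<rfloor>"
  have m: "2 * of_int m \<le> x \<bullet> e" "x \<bullet> e < 2 * of_int m + 2"
    unfolding m_def by linarith+
  have ee: "e \<bullet> e = 1" using assms(1) by (simp add: norm_eq_1)
  have "\<bar>(pos i *\<^sub>R e - y) \<bullet> e\<bar> \<le> rad i"
    using Cauchy_Schwarz_ineq2[of "pos i *\<^sub>R e - y" e] assms(1,2) by (simp add: blob_def dist_norm)
  then have "\<bar>pos i - y \<bullet> e\<bar> \<le> rad i" by (simp add: inner_diff_left ee)
  then have y: "2 * real (cluster i) \<le> y \<bullet> e" "y \<bullet> e \<le> 2 * real (cluster i) + 1"
    using rad_pos(1)[of i] rad_le[of i] by (auto simp: pos_def)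
  have xy: "\<bar>x \<bullet> e - y \<bullet> e\<bar> \<le> norm (x - y)"
    using Cauchy_Schwarz_ineq2[of "x - y" e] assms(1) by (simp add: inner_diff_left)
  consider "int (cluster i) \<le> m - 1" | "int (cluster i) \<ge> m + 2"
    using assms(3,4) by (fold m_def) linarith
  then show ?thesis
  proof cases
    case 1
    then have "real (cluster i) \<le> of_int m - 1" by linarith
    then show ?thesis using m y xy by linarith
  next
    case 2
    then have "real (cluster i) \<ge> of_int m + 2" by linarith
    then show ?thesis using m y xy by linarith
  qed
qed

text \<open>A ball contributes at most \<open>C / Suc i\<close> at any point, so the at most two nearby clusters contribute
  at most \<open>C\<close> each; the kernel is at most \<open>1\<close> on the others, whose contribution is bounded by the
  total mass.\<close>
lemma scattered_potential_bounded:
  fixes e :: "real ^ 'n"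
  assumes "norm e = 1" "0 < t" "t < real CARD('n)"
  shows "(SUP x. \<integral>\<^sup>+ y. riesz_kernel t x y \<partial>scattered e t) < \<infinity>"
proof -
  obtain C where C: "1 \<le> C" "\<And>(a :: real ^ 'n) r x. 0 < r \<Longrightarrow>
       (\<integral>\<^sup>+ y. riesz_kernel t x y \<partial>uniform_measure lborel (cball a r)) \<le> ennreal (C * r powr - t)"
    using uniform_cball_potential_bound[of t] assms by auto
  define W where "W = (\<Sum>i. ennreal (weight t i))"
  let ?h = "\<lambda>m i. ennreal (if int (cluster i) = m then 1 / real (Suc i) else 0)"
  have "(\<integral>\<^sup>+ y. riesz_kernel t x y \<partial>scattered e t) \<le> ennreal C * 2 + W" for x
  proof -
    define m where "m = \<lfloor>(x \<bullet> e) / 2\<rfloor>"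
    let ?P = "\<lambda>i. \<integral>\<^sup>+ y. riesz_kernel t x y \<partial>uniform_measure lborel (blob e i)"
    have "(\<integral>\<^sup>+ y. riesz_kernel t x y \<partial>scattered e t) = (\<Sum>i. ennreal (weight t i) * ?P i)"
      by (rule nn_integral_scattered) measurable
    also have "\<dots> \<le> (\<Sum>i. ennreal C * (?h m i + ?h (m + 1) i) + ennreal (weight t i))"
    proof (intro suminf_le)
      fix i
      show "ennreal (weight t i) * ?P i \<le> ennreal C * (?h m i + ?h (m + 1) i) + ennreal (weight t i)"
      proof (cases "int (cluster i) = m \<or> int (cluster i) = m + 1")
        case True
        have "ennreal (weight t i) * ?P i \<le> ennreal (weight t i) * ennreal (C * rad i powr - t)"
          using C(2)[of "rad i" "pos i *\<^sub>R e" x] by (intro mult_left_mono) (auto simp: blob_def)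
        also have "\<dots> = ennreal (C * (1 / real (Suc i)))"
          using C(1) by (subst ennreal_mult[symmetric]) (auto simp: weight_def powr_minus field_simps)
        also have "\<dots> = ennreal C * ennreal (1 / real (Suc i))"
          using C(1) by (intro ennreal_mult) auto
        also have "ennreal (1 / real (Suc i)) = ?h m i + ?h (m + 1) i"
          using True by auto
        also have "ennreal C * \<dots> \<le> ennreal C * (?h m i + ?h (m + 1) i) + ennreal (weight t i)"
          by (rule le_iff_add[THEN iffD2]) blast
        finally show ?thesis .
      next
        case False
        have "?P i \<le> ennreal (1 powr - t)"
          using False assms blob_far[OF assms(1), of _ i x, folded m_def]
          by (intro nn_integral_blob_le riesz_kernel_le) auto
        then have "ennreal (weight t i) * ?P i \<le> ennreal (weight t i) * 1"
          by (intro mult_left_mono) auto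
        then show ?thesis using False by simp
      qed
    qed auto
    also have "\<dots> = ennreal C * ((\<Sum>i. ?h m i) + (\<Sum>i. ?h (m + 1) i)) + W"
      unfolding W_def by (simp only: suminf_add[symmetric] ennreal_suminf_cmult summableI)
    also have "\<dots> \<le> ennreal C * (1 + 1) + W"
      by (intro add_mono mult_left_mono cluster_mass_le order_refl) auto
    finally show ?thesis by simp
  qed
  then have "(SUP x. \<integral>\<^sup>+ y. riesz_kernel t x y \<partial>scattered e t) \<le> ennreal C * 2 + W"
    by (intro SUP_least)
  also have "\<dots> < \<infinity>"
    using weight_sum_finite[OF assms(2)] by (auto simp: W_def[symmetric] ennreal_mult_less_top)
  finally show ?thesis .
qed

section \<open>Point masses at the cluster centres\<close>

text \<open>The sum of the unit point masses at the centres of the first \<open>J\<close> clusters, encoded as the image of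
  counting measure.\<close>
definition point_masses :: "real ^ 'n \<Rightarrow> nat \<Rightarrow> (real ^ 'n) measure" where
  "point_masses e J = distr (count_space {..<J}) borel (\<lambda>j. (2 * real j) *\<^sub>R e)"

lemma emeasure_point_masses: "emeasure (point_masses e J) UNIV = of_nat J"
  unfolding point_masses_def by (subst emeasure_distr) auto

lemma point_masses_radon: "point_masses e J \<in> radon_measures"
proof -
  have "emeasure (point_masses e J) K \<le> of_nat J" for K
    using emeasure_space[of "point_masses e J" K] emeasure_point_masses[of e J]
    by (simp add: point_masses_def)
  then show ?thesis
    unfolding radon_measures_def
    using le_less_trans[OF _ of_nat_less_top[of J]] by (auto simp: point_masses_def)
qed

lemma riesz_potential_point_masses:
  "riesz_potential \<beta> (point_masses e J) (x :: real ^ 'n)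
     = (\<Sum>j<J. riesz_kernel (real CARD('n) - \<beta>) x ((2 * real j) *\<^sub>R e))"
  unfolding riesz_potential_def point_masses_def
  by (subst nn_integral_distr) (auto simp: nn_integral_count_space_finite)

text \<open>Oresme: every dyadic block of the harmonic series has sum at least \<open>1 / 2\<close>.\<close>
lemma harmonic_dyadic_ge: "real J / 2 \<le> (\<Sum>i<2 ^ J - 1. 1 / real (Suc i))"
proof (induction J)
  case (Suc J)
  have eq: "{..<2 ^ Suc J - 1} = {..<2 ^ J - 1} \<union> {2 ^ J - 1..<2 * 2 ^ J - (1 :: nat)}"
    by (auto simp: not_less)
  have "(\<Sum>i\<in>{2 ^ J - 1..<2 * 2 ^ J - (1 :: nat)}. 1 / (2 * 2 ^ J))
      \<le> (\<Sum>i\<in>{2 ^ J - 1..<2 * 2 ^ J - (1 :: nat)}. 1 / real (Suc i))"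
  proof (intro sum_mono)
    fix i assume "i \<in> {2 ^ J - 1..<2 * 2 ^ J - (1 :: nat)}"
    then have "Suc i \<le> 2 * 2 ^ J" by auto
    then have "real (Suc i) \<le> real (2 * 2 ^ J)" by (rule of_nat_mono)
    then have "real (Suc i) \<le> 2 * 2 ^ J" by simp
    then show "1 / (2 * 2 ^ J) \<le> 1 / real (Suc i)" by (intro divide_left_mono) auto
  qed
  also have "(\<Sum>i\<in>{2 ^ J - 1..<2 * 2 ^ J - (1 :: nat)}. 1 / (2 * 2 ^ J)) = (1 / 2 :: real)"
    by simp
  finally have "1 / 2 \<le> (\<Sum>i\<in>{2 ^ J - 1..<2 * 2 ^ J - (1 :: nat)}. 1 / real (Suc i))" .
  moreover have "(\<Sum>i<2 ^ Suc J - 1. 1 / real (Suc i)) = (\<Sum>i<2 ^ J - 1. 1 / real (Suc i))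
      + (\<Sum>i\<in>{2 ^ J - 1..<2 * 2 ^ J - (1 :: nat)}. 1 / real (Suc i))"
    unfolding eq by (intro sum.union_disjoint) auto
  ultimately show ?case using Suc.IH by simp
qed simp

text \<open>On a ball of cluster \<open>k\<close> it is enough to keep the point mass at the centre of that cluster, which
  lies within \<open>9 * rad i\<close>. The ball then contributes at least \<open>9 powr - t / Suc i\<close>, and the first
  \<open>J\<close> clusters are the indices below \<open>2 ^ J - 1\<close>.\<close>
lemma point_masses_Lq_lower:
  fixes e :: "real ^ 'n"
  assumes "norm e = 1" "0 < q" "\<beta> < real CARD('n)"
  defines "t \<equiv> (real CARD('n) - \<beta>) * q"
  shows "ennreal (9 powr - t / 2 * real J)
     \<le> (\<integral>\<^sup>+ x. ennreal_powr (riesz_potential \<beta> (point_masses e J) x) q \<partial>scattered e t)"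
proof -
  define s where "s = real CARD('n) - \<beta>"
  have s: "0 < s" "t = s * q" "0 < t" using assms by (auto simp: s_def t_def)
  let ?g = "\<lambda>x. ennreal_powr (riesz_potential \<beta> (point_masses e J) x) q"
  have [measurable]: "riesz_potential \<beta> (point_masses e J) \<in> borel_measurable borel"
  proof -
    have "(\<lambda>x. \<Sum>j<J. riesz_kernel (real CARD('n) - \<beta>) x ((2 * real j) *\<^sub>R e)) \<in> borel_measurable borel"
      by measurable
    then show ?thesis by (simp add: riesz_potential_point_masses[abs_def])
  qed
  have on_blob: "ennreal ((9 * rad i) powr - t) \<le> ?g x"
    if i: "i < 2 ^ J - 1" and x: "x \<in> blob e i" for i x
  proof -
    have "Suc i < 2 ^ J" using i by simp
    then have "2 ^ cluster i < (2 :: nat) ^ J" using cluster_bounds(1)[of i] by linarith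
    then have cJ: "cluster i < J" by simp
    have "norm (x - (2 * real (cluster i)) *\<^sub>R e) \<le> norm (x - pos i *\<^sub>R e) + norm (pos i *\<^sub>R e - (2 * real (cluster i)) *\<^sub>R e)"
      using norm_triangle_ineq[of "x - pos i *\<^sub>R e" "pos i *\<^sub>R e - (2 * real (cluster i)) *\<^sub>R e"] by simp
    also have "norm (pos i *\<^sub>R e - (2 * real (cluster i)) *\<^sub>R e) = 8 * rad i"
      using assms(1) by (simp add: pos_def flip: scaleR_diff_left)
    also have "norm (x - pos i *\<^sub>R e) \<le> rad i"
      using x by (simp add: blob_def dist_norm norm_minus_commute)
    finally have "ennreal ((9 * rad i) powr - s) \<le> riesz_kernel s x ((2 * real (cluster i)) *\<^sub>R e)"
      using s by (intro riesz_kernel_ge) auto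
    also have "\<dots> \<le> riesz_potential \<beta> (point_masses e J) x"
      unfolding riesz_potential_point_masses s_def[symmetric]
      using cJ by (intro member_le_sum) auto
    finally have "ennreal_powr (ennreal ((9 * rad i) powr - s)) q \<le> ?g x"
      using assms(2) by (intro ennreal_powr_mono) auto
    then show ?thesis
      by (subst (asm) ennreal_powr_ennreal) (auto simp: powr_powr s)
  qed
  have "9 powr - t / 2 * real J \<le> (\<Sum>i<2 ^ J - 1. 9 powr - t * (1 / real (Suc i)))"
    using mult_left_mono[OF harmonic_dyadic_ge[of J], of "9 powr - t"] by (simp add: sum_distrib_left)
  then have "ennreal (9 powr - t / 2 * real J) \<le> ennreal (\<Sum>i<2 ^ J - 1. 9 powr - t * (1 / real (Suc i)))"
    by (rule ennreal_leI)
  also have "\<dots> = (\<Sum>i<2 ^ J - 1. ennreal (9 powr - t * (1 / real (Suc i))))"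
    by (rule sum_ennreal[symmetric]) simp
  also have "\<dots> \<le> (\<Sum>i<2 ^ J - 1. ennreal (weight t i) * (\<integral>\<^sup>+ x. ?g x \<partial>uniform_measure lborel (blob e i)))"
  proof (rule sum_mono)
    fix i :: nat assume "i \<in> {..<2 ^ J - 1}"
    then have i: "i < 2 ^ J - 1" by simp
    have "rad i powr t * rad i powr - t = 1" by (simp flip: powr_add)
    then have "weight t i * (9 * rad i) powr - t = 9 powr - t * (1 / real (Suc i))"
      by (simp add: weight_def powr_mult)
    then have "ennreal (9 powr - t * (1 / real (Suc i))) = ennreal (weight t i) * ennreal ((9 * rad i) powr - t)"
      by (simp add: ennreal_mult[symmetric])
    also have "\<dots> \<le> ennreal (weight t i) * (\<integral>\<^sup>+ x. ?g x \<partial>uniform_measure lborel (blob e i))"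
      by (intro mult_left_mono nn_integral_blob_ge on_blob[OF i]) auto
    finally show "ennreal (9 powr - t * (1 / real (Suc i))) \<le> ennreal (weight t i) * (\<integral>\<^sup>+ x. ?g x \<partial>uniform_measure lborel (blob e i))" .
  qed
  also have "\<dots> \<le> (\<Sum>i. ennreal (weight t i) * (\<integral>\<^sup>+ x. ?g x \<partial>uniform_measure lborel (blob e i)))"
    by (intro sum_le_suminf) auto
  also have "\<dots> = (\<integral>\<^sup>+ x. ?g x \<partial>scattered e t)"
    by (rule nn_integral_scattered[symmetric]) measurable
  finally show ?thesis .
qed

text \<open>Up to a constant the quotient is at least \<open>J powr (1 / q - 1)\<close>, with a positive exponent because
  \<open>q < 1\<close>.\<close>
lemma point_masses_ratio_unbounded:
  fixes e :: "real ^ 'n"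
  assumes "norm e = 1" "0 < q" "q < 1" "\<beta> < real CARD('n)"
  defines "t \<equiv> (real CARD('n) - \<beta>) * q"
  shows "(SUP \<nu> \<in> {\<nu> \<in> radon_measures. \<nu> \<noteq> null_measure borel \<and> emeasure \<nu> UNIV < \<infinity>}.
          Lq_norm q (scattered e t) (riesz_potential \<beta> \<nu>) / emeasure \<nu> UNIV) = \<infinity>"
  unfolding infinity_ennreal_def
proof (rule ennreal_SUP_eq_top)
  fix n :: nat
  define c where "c = 9 powr - t / 2"
  define u where "u = 1 / q - 1"
  have c: "0 < c" by (simp add: c_def)
  have u: "0 < u" using assms by (simp add: u_def)
  \<comment> \<open>Solves \<open>c powr (1 / q) * B powr u = n\<close>; \<open>J\<close> below is an integer above \<open>B\<close>.\<close>
  define B where "B = (real n / c powr (1 / q)) powr (1 / u)"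
  define J where "J = Suc (nat \<lceil>B\<rceil>)"
  have J: "0 < real J" "B \<le> real J" unfolding J_def by linarith+
  have "real n / c powr (1 / q) = B powr u"
    using u c by (simp add: B_def powr_powr)
  also have "\<dots> \<le> real J powr u"
    using J u by (intro powr_mono2) (auto simp: B_def)
  finally have n: "real n \<le> c powr (1 / q) * real J powr u"
    using c by (simp add: field_simps)
  let ?\<nu> = "point_masses e J"
  have "of_nat n = ennreal (real n)" by (simp add: ennreal_of_nat_eq_real_of_nat)
  also have "\<dots> \<le> ennreal (c powr (1 / q) * real J powr u)" using n by (rule ennreal_leI)
  also have "c powr (1 / q) * real J powr u = (c * real J) powr (1 / q) / real J"
    using J c by (simp add: u_def powr_mult powr_diff)
  also have "ennreal \<dots> = ennreal_powr (ennreal (c * real J)) (1 / q) / emeasure ?\<nu> UNIV"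
    using J c by (simp add: ennreal_powr_ennreal emeasure_point_masses divide_ennreal ennreal_of_nat_eq_real_of_nat)
  also have "\<dots> \<le> Lq_norm q (scattered e t) (riesz_potential \<beta> ?\<nu>) / emeasure ?\<nu> UNIV"
    unfolding Lq_norm_def c_def t_def using assms
    by (intro divide_right_mono_ennreal ennreal_powr_mono point_masses_Lq_lower) auto
  finally have "of_nat n \<le> Lq_norm q (scattered e t) (riesz_potential \<beta> ?\<nu>) / emeasure ?\<nu> UNIV" .
  moreover have "?\<nu> \<noteq> null_measure borel"
  proof
    assume "?\<nu> = null_measure borel"
    then have "emeasure ?\<nu> UNIV = 0" by simp
    then show False using J by (simp add: emeasure_point_masses)
  qed
  ultimately show "\<exists>\<nu>\<in>{\<nu> \<in> radon_measures. \<nu> \<noteq> null_measure borel \<and> emeasure \<nu> UNIV < top}.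
      of_nat n \<le> Lq_norm q (scattered e t) (riesz_potential \<beta> \<nu>) / emeasure \<nu> UNIV"
    using point_masses_radon[of e J] by (intro bexI[of _ ?\<nu>]) (auto simp: emeasure_point_masses of_nat_less_top)
qed

theorem mainTheorem2:
  fixes q \<alpha> :: real
  assumes "0 < q" and "q < 1"
    and "0 < 2 * \<alpha>" and "2 * \<alpha> < real CARD('n::finite)"
  shows "\<exists>\<sigma> \<in> (radon_measures :: (real ^ 'n) measure set).
      (\<integral>\<^sup>+ x. ennreal_powr (riesz_potential (2 * \<alpha>) \<sigma> x) (q / (1 - q)) \<partial>\<sigma>) < \<infinity> \<and>
      (SUP x. \<integral>\<^sup>+ y. riesz_kernel ((real CARD('n) - 2 * \<alpha>) * q) x y \<partial>\<sigma>) < \<infinity> \<and>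
      (SUP \<nu> \<in> {\<nu> \<in> radon_measures. \<nu> \<noteq> null_measure borel \<and> emeasure \<nu> UNIV < \<infinity>}.
          Lq_norm q \<sigma> (riesz_potential (2 * \<alpha>) \<nu>) / emeasure \<nu> UNIV) = \<infinity>"
proof -
  define e :: "real ^ 'n" where "e = axis undefined 1"
  have e: "norm e = 1" by (simp add: e_def)
  let ?t = "(real CARD('n) - 2 * \<alpha>) * q"
  have "?t < (real CARD('n) - 2 * \<alpha>) * 1"
    using assms by (intro mult_strict_left_mono) auto
  also have "\<dots> < real CARD('n)" using assms by simp
  finally have "?t < real CARD('n)" .
  moreover have "0 < ?t" using assms by simp
  ultimately have t: "0 < ?t" "?t < real CARD('n)" by auto
  show ?thesis
    using scattered_radon[OF t(1)] scattered_energy_finite[OF e assms]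
      scattered_potential_bounded[OF e t] point_masses_ratio_unbounded[OF e assms(1,2,4)]
    by blast
qed

end
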